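(* Let $r>1$ and $t\ge 1$ be integers. Define $$F(z)=4z^r\binom{r+t-1}{r}\,{}_2F_1(1-t,r;r+1;z)\left(1-(1-z)^t z^r\binom{r+t-1}{t-1}\,{}_2F_1(1,r+t;r+1;z)\right).$$ Then $F$ is a Shabat polynomial whose associated tree has passport $[r,t,1^{r+t-2};2^{r+t-1}]$, with a black vertex of degree $r$ located at $z=0$ and a black vertex of degree $t$ located at $z=1$. Moreover $F$ is, up to isomorphism, the Shabat polynomial for this passport, i.e. every Shabat polynomial whose tree has passport $[r,t,1^{r+t-2};2^{r+t-1}]$ is isomorphic to $F$.
   Context: A Shabat polynomial is a nonconstant polynomial $F:\mathbb{C}\to\mathbb{C}$ all of whose critical values lie in $\{0,1\}$. Its associated tree (dessin) is the bicolored plane tree $F^{-1}([0,1])$, with black vertices $F^{-1}(0)$, white vertices $F^{-1}(1)$, and edges the connected components of $F^{-1}((0,1))$; the degree of a black (resp. white) vertex is the multiplicity of the corresponding root of $F$ (resp. $F-1$). The passport of the tree is the pair of lists $[b_1,\dots,b_k;w_1,\dots,w_\ell]$ of degrees of the black vertices and of the white vertices (each list taken as a multiset); within a list, $a^m$ denotes $m$ vertices of degree $a$. Two Shabat polynomials $F,G$ are isomorphic if there exist $\alpha,\beta\in\mathbb{C}$ with $F(z)=G(\alpha z+\beta)$. The hypergeometric function is ${}_2F_1(a,b;c;z)=\sum_{n\ge 0}\frac{(a)_n(b)_n}{(c)_n}\frac{z^n}{n!}$, where $(a)_n=a(a+1)\cdots(a+n-1)$ and $(a)_0=1$. The expression for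 $F$ is to be read as an identity of power series near $z=0$ (the right-hand side is a polynomial). *)

theory Defs
  imports
    "HOL-Analysis.Analysis"
    "HOL-Computational_Algebra.Computational_Algebra"
begin

definition shabat :: "complex poly \<Rightarrow> bool" where
  "shabat F \<longleftrightarrow> degree F > 0 \<and> (\<forall>z. poly (pderiv F) z = 0 \<longrightarrow> poly F z \<in> {0, 1})"

record plane_tree =
  support :: "complex set"
  black :: "complex set"
  white :: "complex set"
  edges :: "complex set set"
  vertex_degree :: "complex \<Rightarrow> nat"

text \<open>
  The intervals are taken inside the complex plane, as images of the real ones.
  The value of \<open>vertex_degree\<close> is irrelevant away from the vertices.
\<close>

definition dessin :: "complex poly \<Rightarrow> plane_tree" where
  "dessin F =
     \<lparr> support = poly F -` (of_real ` {0..1}),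
       black = {z. poly F z = 0},
       white = {z. poly F z = 1},
       edges = components (poly F -` (of_real ` {0<..<1})),
       vertex_degree = (\<lambda>z. if poly F z = 0 then order z F else order z (F - 1)) \<rparr>"

text \<open>
  The lists of degrees are taken as multisets. For a nonconstant polynomial both
  vertex sets are finite, so \<open>mset_set\<close> does not collapse to the empty multiset.
\<close>

definition passport :: "plane_tree \<Rightarrow> nat multiset \<times> nat multiset" where
  "passport T =
     (image_mset (vertex_degree T) (mset_set (black T)),
      image_mset (vertex_degree T) (mset_set (white T)))"

text \<open>No condition on \<open>\<alpha>\<close> is needed: it is nonzero whenever \<open>F\<close> is nonconstant.\<close>

definition shabat_isomorphic :: "complex poly \<Rightarrow> complex poly \<Rightarrow> bool" where
  "shabat_isomorphic F G \<longleftrightarrow> (\<exists>\<alpha> \<beta>. \<forall>z. poly F z = poly G (\<alpha> * z + \<beta>))"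

text \<open>
  The hypergeometric function with parameters \<open>a, b; c\<close> as a power series in \<open>z\<close>;
  the last argument of \<^const>\<open>fps_hypergeo\<close> is a scaling factor of the variable.
\<close>

definition hyp2F1 :: "complex \<Rightarrow> complex \<Rightarrow> complex \<Rightarrow> complex fps" where
  "hyp2F1 a b c = fps_hypergeo [a, b] [c] 1"

lemma hyp2F1_nth:
  "fps_nth (hyp2F1 a b c) n = pochhammer a n * pochhammer b n / (pochhammer c n * fact n)"
  by (simp add: hyp2F1_def fps_hypergeo_def)

end

theory Submission
  imports Defs
begin

text \<open>
  Write \<open>n = r + t - 1\<close>. Both hypergeometric expressions in the statement are the same polynomial
  \<open>A\<close>, the regularised incomplete beta function \<open>I\<^sub>z(r, t)\<close>: the polynomial of degree \<open>n\<close> with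
  \<open>A(0) = 0\<close>, \<open>A(1) = 1\<close> and \<open>A'\<close> a multiple of \<open>z\<^sup>r\<^sup>-\<^sup>1 (1 - z)\<^sup>t\<^sup>-\<^sup>1\<close>. It is defined below as a tail of
  the Bernstein basis, so that its end values are evident and its derivative telescopes. The
  coincidence (a case of Euler's transformation) holds because both
  \<open>H = \<^sub>2F\<^sub>1(1 - t, r; r + 1; z)\<close> and \<open>H = (1 - z)\<^sup>t \<^sub>2F\<^sub>1(1, r + t; r + 1; z)\<close> solve
  \<open>z H' + r H = r (1 - z)\<^sup>t\<^sup>-\<^sup>1\<close>, that is,
  \<open>(z\<^sup>r H)' = r z\<^sup>r\<^sup>-\<^sup>1 (1 - z)\<^sup>t\<^sup>-\<^sup>1\<close>.

  Hence \<open>F = 4 A (1 - A) = 1 - (1 - 2 A)\<^sup>2\<close> and \<open>F' = 4 A' (1 - 2 A)\<close>. A zero of \<open>1 - 2 A\<close> is a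
  simple zero of it, as \<open>A'\<close> vanishes at most at 0 and 1, where \<open>A\<close> is not \<open>1/2\<close>; so it is a point
  of order 2 over the value 1. The points over the value 0 are those where \<open>A\<close> is 0 or 1; these have order \<open>r\<close> at 0,
  order \<open>t\<close> at 1, and order 1 elsewhere. The numbers of vertices follow by comparing degrees.

  Conversely, if every white vertex of \<open>G\<close> has degree 2, then \<open>G - 1\<close> is a square and
  \<open>G = 4 B (1 - B)\<close> with \<open>B\<close> of degree \<open>n\<close>. Let \<open>b\<close> and \<open>c\<close> be black vertices of degrees \<open>r\<close> and
  \<open>t\<close>; exchanging \<open>B\<close> and \<open>1 - B\<close> if needed, \<open>B(b) = 0\<close>. Since \<open>r + t > n\<close>, \<open>B\<close> cannot have zeros
  of both orders, so \<open>B(c) = 1\<close>. Now \<open>B'\<close> has degree \<open>(r - 1) + (t - 1)\<close> and zeros of orders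
  \<open>r - 1\<close> at \<open>b\<close> and \<open>t - 1\<close> at \<open>c\<close>, which determines it up to a factor, and the affine map taking
  0 to \<open>b\<close> and 1 to \<open>c\<close> turns \<open>B\<close> into \<open>A\<close>.
\<close>

(* Keeps the dollar sign for coefficients of formal power series. *)
unbundle no vec_syntax

section \<open>The regularised incomplete beta polynomial\<close>

text \<open>
  The regularised incomplete beta function \<open>I\<^sub>z(r, t)\<close> for positive integers \<open>r\<close> and \<open>t\<close>, as the sum
  of the Bernstein polynomials of degree \<open>r + t - 1\<close> with index at least \<open>r\<close>; the factor
  \<open>[:1, -1:]\<close> is \<open>1 - z\<close>.
\<close>

definition inc_beta :: "nat \<Rightarrow> nat \<Rightarrow> complex poly" where
  "inc_beta r t = (\<Sum>j = r..r + t - 1.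
     smult (of_nat ((r + t - 1) choose j)) ([:0, 1:] ^ j * [:1, -1:] ^ (r + t - 1 - j)))"

text \<open>
  The derivative of a Bernstein polynomial of degree \<open>m + 1\<close> is \<open>m + 1\<close> times the difference of two
  consecutive ones of degree \<open>m\<close>. For \<open>k = m\<close> the subtracted term is zero, its binomial coefficient
  being zero.
\<close>

lemma pderiv_bernstein:
  assumes "k \<le> m"
  shows "pderiv (smult (of_nat (Suc m choose Suc k)) ([:0, 1:] ^ Suc k * [:1, -1:] ^ (m - k)))
       = smult (of_nat (Suc m * (m choose k))) ([:0, 1:] ^ k * [:1, -1:] ^ (m - k))
       - smult (of_nat (Suc m * (m choose Suc k)))
           ([:0, 1:] ^ Suc k * [:1, -1:] ^ (m - Suc k) :: complex poly)"
proof -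
  let ?X = "[:0, 1:] :: complex poly" and ?Y = "[:1, -1:] :: complex poly"
  have 1: "Suc k * (Suc m choose Suc k) = Suc m * (m choose k)"
    using Suc_times_binomial_eq[of m k] by (simp only: mult.commute)
  have 2: "(m - k) * (Suc m choose Suc k) = Suc m * (m choose Suc k)"
    using binomial_absorb_comp[of "Suc m" "Suc k"] by simp
  have "pderiv (?X ^ Suc k * ?Y ^ (m - k)) =
      smult (of_nat (Suc k)) (?X ^ k * ?Y ^ (m - k))
      - smult (of_nat (m - k)) (?X ^ Suc k * ?Y ^ (m - Suc k))"
    by (simp add: pderiv_mult pderiv_power_Suc pderiv_power pderiv_pCons algebra_simps
        del: power_Suc)
  hence "pderiv (smult (of_nat (Suc m choose Suc k)) (?X ^ Suc k * ?Y ^ (m - k)))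
      = smult (of_nat (Suc k * (Suc m choose Suc k))) (?X ^ k * ?Y ^ (m - k))
      - smult (of_nat ((m - k) * (Suc m choose Suc k))) (?X ^ Suc k * ?Y ^ (m - Suc k))"
    by (simp only: pderiv_smult smult_diff_right smult_smult of_nat_mult mult.commute)
  thus ?thesis by (simp only: 1 2)
qed

lemma pderiv_sum: "pderiv (sum f A) = (\<Sum>x\<in>A. pderiv (f x))"
  by (induction A rule: infinite_finite_induct) (simp_all add: pderiv_add)

lemma pderiv_inc_beta:
  assumes "r \<ge> 1" "t \<ge> 1"
  shows "pderiv (inc_beta r t) =
    smult (of_nat (r * ((r + t - 1) choose r))) ([:0, 1:] ^ (r - 1) * [:1, -1:] ^ (t - 1))"
proof -
  define k m where "k = r - 1" and "m = r + t - 2"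
  have r: "r = Suc k" and m: "r + t - 1 = Suc m" and km: "k \<le> m" and t: "t - 1 = m - k"
    using assms by (auto simp: k_def m_def)
  have k: "r - 1 = k" using r by simp
  have e: "r * ((r + t - 1) choose r) = Suc m * (m choose k)"
    unfolding m unfolding r using Suc_times_binomial_eq[of m k] by (simp only: mult.commute)
  define c :: "nat \<Rightarrow> complex poly" where
    "c j = smult (of_nat (Suc m * (m choose j))) ([:0, 1:] ^ j * [:1, -1:] ^ (m - j))" for j
  have "pderiv (inc_beta r t) = (\<Sum>j = k..m.
     pderiv (smult (of_nat (Suc m choose Suc j)) ([:0, 1:] ^ Suc j * [:1, -1:] ^ (m - j))))"
    unfolding inc_beta_def m unfolding r sum.shift_bounds_cl_Suc_ivl pderiv_sum by simp
  also have "\<dots> = (\<Sum>j = k..m. c j - c (Suc j))"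
    by (intro sum.cong refl, subst pderiv_bernstein) (auto simp: c_def)
  also have "\<dots> = - (\<Sum>j = k..m. c (Suc j) - c j)"
    by (simp add: sum_negf [symmetric])
  also have "\<dots> = c k - c (Suc m)"
    using km by (subst sum_Suc_diff) auto
  also have "c (Suc m) = 0"
    by (simp add: c_def binomial_eq_0)
  also have "c k - 0 = smult (of_nat (r * ((r + t - 1) choose r)))
      ([:0, 1:] ^ (r - 1) * [:1, -1:] ^ (t - 1))"
    unfolding c_def e k t by simp
  finally show ?thesis .
qed

lemma poly_inc_beta_0: "r \<ge> 1 \<Longrightarrow> poly (inc_beta r t) 0 = 0"
  by (auto simp: inc_beta_def poly_sum intro!: sum.neutral)

lemma poly_inc_beta_1:
  assumes "t \<ge> 1"
  shows "poly (inc_beta r t) 1 = 1"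
proof -
  have "poly (inc_beta r t) 1 =
      (\<Sum>j = r..r + t - 1. if j = r + t - 1 then 1 else 0)"
    unfolding inc_beta_def poly_sum by (intro sum.cong refl) (auto simp: power_0_left)
  thus ?thesis using assms by simp
qed

lemma pderiv_eq_imp_eq:
  fixes p q :: "complex poly"
  assumes "pderiv p = pderiv q" "poly p a = poly q a"
  shows "p = q"
proof -
  have "pderiv (p - q) = 0" using assms by (simp add: pderiv_diff)
  then obtain h where h: "p - q = [:h:]" using pderiv_iszero by blast
  have "h = poly (p - q) a" by (simp add: h)
  hence "h = 0" using assms by simp
  thus ?thesis using h by simp
qed

text \<open>
  The scalar \<open>k\<close> in the derivative is arbitrary: the value at 1 forces it to be the right one.
\<close>

lemma inc_beta_unique:
  assumes "r \<ge> 1" "t \<ge> 1"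
    and B: "pderiv B = smult k ([:0, 1:] ^ (r - 1) * [:1, -1:] ^ (t - 1))"
    and "poly B 0 = 0" "poly B 1 = 1"
  shows "B = inc_beta r t"
proof -
  define c :: complex where "c = of_nat (r * ((r + t - 1) choose r))"
  have c: "c \<noteq> 0" using assms by (simp add: c_def)
  have "B = smult (k / c) (inc_beta r t)"
  proof (rule pderiv_eq_imp_eq[where a = 0])
    show "pderiv B = pderiv (smult (k / c) (inc_beta r t))"
      using c unfolding B pderiv_smult pderiv_inc_beta[OF assms(1,2)] c_def [symmetric] by simp
  qed (use assms poly_inc_beta_0 in auto)
  moreover from this have "k / c = 1"
    using assms poly_inc_beta_1[of t r] by auto
  ultimately show ?thesis by simp
qed

section \<open>Hypergeometric expressions for the incomplete beta polynomial\<close>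

text \<open>
  The differential equation says that \<open>(z\<^sup>r H)' = r z\<^sup>r\<^sup>-\<^sup>1 (1 - z)\<^sup>t\<^sup>-\<^sup>1\<close>, which determines \<open>z\<^sup>r H\<close>.
\<close>

lemma fps_eq_inc_beta:
  fixes H :: "complex fps"
  assumes "r \<ge> 1" "t \<ge> 1"
    and ode: "fps_X * fps_deriv H + of_nat r * H = of_nat r * (1 - fps_X) ^ (t - 1)"
  shows "of_nat ((r + t - 1) choose r) * fps_X ^ r * H = fps_of_poly (inc_beta r t)"
proof -
  let ?C = "of_nat ((r + t - 1) choose r) :: complex fps"
  obtain k where r: "r = Suc k" using assms by (cases r) auto
  have Y: "fps_of_poly [:1, -1:] = (1 - fps_X :: complex fps)"
    by (simp add: fps_of_poly_pCons flip: fps_const_neg)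
  have "fps_deriv (fps_X ^ r :: complex fps) = of_nat r * fps_X ^ k"
    unfolding r fps_deriv_power' by simp
  hence "fps_deriv (?C * fps_X ^ r * H) =
      ?C * (of_nat r * fps_X ^ k) * H + ?C * (fps_X * fps_X ^ k) * fps_deriv H"
    unfolding fps_deriv_mult by (simp add: r del: of_nat_Suc binomial_Suc_Suc)
  also have "\<dots> = ?C * (fps_X ^ k * (fps_X * fps_deriv H + of_nat r * H))"
    by (simp only: distrib_left mult_ac add_ac)
  also have "\<dots> = fps_of_poly (pderiv (inc_beta r t))"
    unfolding ode pderiv_inc_beta[OF assms(1,2)] fps_of_poly_smult fps_of_poly_mult fps_of_poly_power Y
    by (simp add: r fps_of_nat [symmetric] algebra_simps del: fps_const_add fps_const_mult binomial_Suc_Suc)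
  finally have "fps_deriv (?C * fps_X ^ r * H) = fps_deriv (fps_of_poly (inc_beta r t))"
    by (simp add: fps_of_poly_pderiv)
  moreover have "(?C * fps_X ^ r * H) $ 0 = fps_of_poly (inc_beta r t) $ 0"
    using poly_inc_beta_0[of r t] assms by (simp add: poly_0_coeff_0)
  ultimately show ?thesis
    using fps_deriv_eq_iff[of "?C * fps_X ^ r * H" "fps_of_poly (inc_beta r t)"] by simp
qed

lemma fps_nth_one_minus_X_power:
  "((1 - fps_X) ^ n) $ k = pochhammer (- of_nat n) k / (fact k :: complex)"
proof -
  have "(1 - fps_X) ^ n = fps_binomial (of_nat n :: complex) oo (fps_const (-1) * fps_X)"
    using one_minus_const_fps_X_power[of "1::complex" n] unfolding fps_const_neg [symmetric] by simp
  thus ?thesis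
    unfolding fps_compose_linear
    by (simp add: fps_binomial_def gbinomial_pochhammer flip: power_mult_distrib)
qed

lemma pochhammer_of_nat_plus_1_nonzero: "pochhammer (of_nat r + 1 :: complex) n \<noteq> 0"
proof -
  have "pochhammer (of_nat (Suc r) :: complex) n = of_nat (pochhammer (Suc r) n)"
    by (rule pochhammer_of_nat)
  thus ?thesis
    using pochhammer_pos[of "Suc r" n] by (simp add: add.commute)
qed

lemma pochhammer_shift: "(b + of_nat n) * pochhammer b n = b * pochhammer (b + 1) n"
  for b :: complex
  using pochhammer_rec[of b n] pochhammer_rec'[of b n] by simp

text \<open>
  The operator \<open>z d/dz + r\<close> multiplies the coefficient of degree \<open>n\<close> by \<open>r + n\<close>. This cancels the
  quotient of the Pochhammer symbols of \<open>r\<close> and \<open>r + 1\<close> up to the factor \<open>r\<close>.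
\<close>

lemma hyp2F1_terminating_ode:
  assumes "r \<ge> 1" "t \<ge> 1"
  shows "fps_X * fps_deriv (hyp2F1 (1 - of_nat t) (of_nat r) (of_nat r + 1))
     + of_nat r * hyp2F1 (1 - of_nat t) (of_nat r) (of_nat r + 1)
     = of_nat r * (1 - fps_X) ^ (t - 1)"
proof (rule fps_ext)
  fix n
  let ?H = "hyp2F1 (1 - of_nat t) (of_nat r) (of_nat r + 1)"
  have nz: "pochhammer (of_nat r + 1 :: complex) n \<noteq> 0"
    by (rule pochhammer_of_nat_plus_1_nonzero)
  have "(fps_X * fps_deriv ?H + of_nat r * ?H) $ n = (of_nat r + of_nat n) * ?H $ n"
    by (cases n) (simp_all add: algebra_simps flip: fps_of_nat)
  also have "\<dots> = pochhammer (1 - of_nat t) n / fact n *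
      ((of_nat r + of_nat n) * pochhammer (of_nat r) n / pochhammer (of_nat r + 1) n)"
    by (simp add: hyp2F1_nth mult_ac)
  also have "(of_nat r + of_nat n :: complex) * pochhammer (of_nat r) n / pochhammer (of_nat r + 1) n
      = of_nat r"
    unfolding pochhammer_shift using nz by simp
  also have "pochhammer (1 - of_nat t) n / fact n * of_nat r
      = (of_nat r * (1 - fps_X) ^ (t - 1) :: complex fps) $ n"
    using assms by (simp add: fps_nth_one_minus_X_power of_nat_diff flip: fps_of_nat)
  finally show "(fps_X * fps_deriv ?H + of_nat r * ?H) $ n
      = (of_nat r * (1 - fps_X) ^ (t - 1)) $ n" .
qed

lemma hyp2F1_nonterminating_ode:
  assumes "r \<ge> 1" "t \<ge> 1"
  defines "K \<equiv> (1 - fps_X) ^ t * hyp2F1 1 (of_nat r + of_nat t) (of_nat r + 1)"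
  shows "fps_X * fps_deriv K + of_nat r * K = of_nat r * (1 - fps_X) ^ (t - 1)"
proof -
  define H :: "complex fps" where "H = hyp2F1 1 (of_nat r + of_nat t) (of_nat r + 1)"
  have nz: "pochhammer (of_nat r + 1 :: complex) n \<noteq> 0" for n
    by (rule pochhammer_of_nat_plus_1_nonzero)
  have nth: "H $ n = pochhammer (of_nat r + of_nat t) n / pochhammer (of_nat r + 1) n" for n
    by (simp add: H_def hyp2F1_nth flip: pochhammer_fact)
  have rec: "(of_nat r + 1 + of_nat n) * H $ Suc n = (of_nat r + of_nat t + of_nat n) * H $ n" for n
    using nz[of n] nz[of "Suc n"] by (simp add: nth pochhammer_rec' field_simps)
  \<comment> \<open>The recurrence \<open>rec\<close> of the coefficients as a first-order differential equation; the constant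
    term \<open>r\<close> comes from the coefficient of degree 0, which \<open>rec\<close> does not cover.\<close>
  have H: "fps_X * fps_deriv H + of_nat r * H
      = fps_X * (fps_X * fps_deriv H + (of_nat r + of_nat t) * H) + of_nat r"
  proof (rule fps_ext)
    fix n
    show "(fps_X * fps_deriv H + of_nat r * H) $ n
      = (fps_X * (fps_X * fps_deriv H + (of_nat r + of_nat t) * H) + of_nat r) $ n"
    proof (cases n)
      case 0
      thus ?thesis by (simp add: nth flip: fps_of_nat)
    next
      case (Suc m)
      have "(fps_X * fps_deriv H + of_nat r * H) $ n = (of_nat r + 1 + of_nat m) * H $ Suc m"
        by (simp add: Suc algebra_simps flip: fps_of_nat)
      also have "\<dots> = (fps_X * (fps_X * fps_deriv H + (of_nat r + of_nat t) * H) + of_nat r) $ n"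
        unfolding rec by (cases m) (simp_all add: Suc algebra_simps flip: fps_of_nat)
      finally show ?thesis .
    qed
  qed
  obtain s where t: "t = Suc s" using assms by (cases t) auto
  have K: "K = (1 - fps_X) ^ t * H" by (simp add: K_def H_def)
  have dY: "fps_deriv ((1 - fps_X) ^ t) = - of_nat t * (1 - fps_X :: complex fps) ^ s"
    unfolding t fps_deriv_power' by simp
  have "fps_X * fps_deriv K + of_nat r * K = (1 - fps_X) ^ s *
      ((1 - fps_X) * (fps_X * fps_deriv H + of_nat r * H) - of_nat t * fps_X * H)"
    unfolding K fps_deriv_mult dY unfolding t power_Suc by (simp add: algebra_simps del: of_nat_Suc)
  also have "(1 - fps_X) * (fps_X * fps_deriv H + of_nat r * H) - of_nat t * fps_X * H = of_nat r"
  proof -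
    define E where "E = fps_X * fps_deriv H + of_nat r * H"
    have "E = fps_X * (E + of_nat t * H) + of_nat r"
      unfolding E_def by (subst H) (simp add: algebra_simps)
    thus ?thesis unfolding E_def [symmetric] by (simp add: algebra_simps)
  qed
  finally show ?thesis by (simp add: t mult.commute)
qed

section \<open>Multiplicities and degrees\<close>

lemma order_power: "p \<noteq> 0 \<Longrightarrow> order a (p ^ n) = n * order a p"
  for p :: "'a :: idom poly"
  by (induction n) (auto simp: order_mult)

text \<open>
  The points over the value \<open>c\<close>; the cases where \<open>c\<close> is 0, 1 or \<open>1/2\<close> give all vertex degrees.
\<close>

lemma order_inc_beta_minus_const:
  assumes "r \<ge> 1" "t \<ge> 1" and z: "poly (inc_beta r t) z = c"
  shows "order z (inc_beta r t - [:c:]) = (if z = 0 then r else if z = 1 then t else 1)"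
proof -
  let ?A = "inc_beta r t"
  have C: "of_nat (r * ((r + t - 1) choose r)) \<noteq> (0::complex)"
    using assms by simp
  have ne: "pderiv (?A - [:c:]) \<noteq> 0"
    using C assms by (simp add: pderiv_diff pderiv_inc_beta pderiv_pCons del: of_nat_mult)
  have oX: "order z [:0, 1:] = (if z = 0 then 1 else 0)"
    using order_power_n_n[of "0::complex" 1] by (auto intro!: order_0I)
  have "order 1 ([:1, -1:] :: complex poly) = 1"
    using order_power_n_n[of "1::complex" 1] order_uminus[of 1 "[:-1, 1::complex:]"] by simp
  hence oY: "order z [:1, -1:] = (if z = 1 then 1 else 0)"
    by (auto intro!: order_0I)
  have "order z (?A - [:c:]) = Suc (order z (pderiv (?A - [:c:])))"
    using ne z by (intro order_pderiv) auto
  also have "order z (pderiv (?A - [:c:])) =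
      order z ([:0, 1:] ^ (r - 1)) + order z ([:1, -1:] ^ (t - 1))"
    using C assms(1,2) by (simp add: pderiv_diff pderiv_inc_beta pderiv_pCons order_smult order_mult
        del: of_nat_mult)
  also have "\<dots> = (r - 1) * order z [:0, 1:] + (t - 1) * order z [:1, -1:]"
    by (simp add: order_power)
  finally show ?thesis using assms by (auto simp: oX oY)
qed

lemma sum_order_eq_degree:
  fixes p :: "complex poly"
  assumes "p \<noteq> 0"
  shows "(\<Sum>z | poly p z = 0. order z p) = degree p"
  using assms size_proots_complex[of p] by (simp add: size_multiset_overloaded_eq)

lemma degree_inc_beta:
  assumes "r \<ge> 1" "t \<ge> 1"
  shows "degree (inc_beta r t) = r + t - 1"
proof -
  have C: "of_nat (r * ((r + t - 1) choose r)) \<noteq> (0::complex)"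
    using assms by simp
  have d: "degree (pderiv (inc_beta r t)) = r - 1 + (t - 1)"
    using C assms by (simp add: pderiv_inc_beta degree_mult_eq degree_power_eq del: of_nat_mult)
  have "degree (inc_beta r t) \<noteq> 0"
    using C assms pderiv_eq_0_iff[of "inc_beta r t"] by (simp add: pderiv_inc_beta del: of_nat_mult)
  thus ?thesis using d assms by (simp add: degree_pderiv)
qed

section \<open>The Shabat polynomial and its passport\<close>

text \<open>The polynomial \<open>F = 4 A (1 - A)\<close>, where \<open>A = I\<^sub>z(r, t)\<close>.\<close>

definition shabat_poly :: "nat \<Rightarrow> nat \<Rightarrow> complex poly" where
  "shabat_poly r t = smult 4 (inc_beta r t * (1 - inc_beta r t))"

lemma poly_shabat_poly:
  "poly (shabat_poly r t) z = 4 * poly (inc_beta r t) z * (1 - poly (inc_beta r t) z)"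
  by (simp add: shabat_poly_def)

lemma shabat_poly_minus_1: "shabat_poly r t - 1 = smult (-4) ((inc_beta r t - [:1/2:]) ^ 2)"
proof (rule poly_ext)
  fix z show "poly (shabat_poly r t - 1) z = poly (smult (-4) ((inc_beta r t - [:1/2:]) ^ 2)) z"
    by (simp add: poly_shabat_poly field_simps power2_eq_square)
qed

lemma degree_shabat_poly:
  assumes "r \<ge> 1" "t \<ge> 1"
  shows "degree (shabat_poly r t) = 2 * (r + t - 1)"
proof -
  let ?A = "inc_beta r t"
  have d: "degree ?A > 0" using degree_inc_beta[OF assms] assms by simp
  have "degree (1 - ?A) = degree ?A"
    using d degree_add_eq_right[of 1 "- ?A"] by simp
  thus ?thesis
    using d degree_inc_beta[OF assms]
    by (subst shabat_poly_def, subst degree_smult_eq, subst degree_mult_eq) auto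
qed

lemma order_black_shabat_poly:
  assumes "r \<ge> 1" "t \<ge> 1" "poly (shabat_poly r t) z = 0"
  shows "order z (shabat_poly r t) = (if z = 0 then r else if z = 1 then t else 1)"
proof -
  let ?A = "inc_beta r t"
  have "shabat_poly r t \<noteq> 0" using degree_shabat_poly[OF assms(1,2)] assms by auto
  hence o: "order z (shabat_poly r t) = order z ?A + order z (1 - ?A)"
    unfolding shabat_poly_def by (subst order_smult, simp, subst order_mult) auto
  have "order z (1 - ?A) = order z (?A - 1)"
    using order_uminus[of z "?A - 1"] by simp
  moreover have "poly ?A z = 0 \<or> poly ?A z = 1"
    using assms by (auto simp: poly_shabat_poly)
  ultimately show ?thesis
    using o order_inc_beta_minus_const[OF assms(1,2), of z]
    by (auto simp: order_0I one_pCons [symmetric])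
qed

lemma order_white_shabat_poly:
  assumes "r \<ge> 1" "t \<ge> 1" "poly (shabat_poly r t) z = 1"
  shows "order z (shabat_poly r t - 1) = 2"
proof -
  have "poly (shabat_poly r t - 1) z = 0" using assms by simp
  hence half: "poly (inc_beta r t) z = 1/2"
    unfolding shabat_poly_minus_1 by simp
  hence "z \<noteq> 0" "z \<noteq> 1"
    using poly_inc_beta_0[of r t] poly_inc_beta_1[of t r] assms by auto
  hence o: "order z (inc_beta r t - [:1/2:]) = 1"
    using order_inc_beta_minus_const[OF assms(1,2) half] by simp
  moreover from this have "inc_beta r t - [:1/2:] \<noteq> 0"
    using degree_inc_beta[OF assms(1,2)] assms by auto
  ultimately show ?thesis
    unfolding shabat_poly_minus_1 by (subst order_smult) (simp_all add: order_power)
qed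

lemma shabat_shabat_poly:
  assumes "r \<ge> 1" "t \<ge> 1"
  shows "shabat (shabat_poly r t)"
  unfolding shabat_def
proof (intro conjI allI impI)
  show "degree (shabat_poly r t) > 0" using degree_shabat_poly[OF assms] assms by simp
  fix z assume z: "poly (pderiv (shabat_poly r t)) z = 0"
  let ?A = "inc_beta r t"
  have "poly (pderiv (shabat_poly r t)) z = 4 * poly (pderiv ?A) z * (1 - 2 * poly ?A z)"
    by (simp add: shabat_poly_def pderiv_smult pderiv_mult pderiv_diff algebra_simps)
  hence "4 * poly (pderiv ?A) z * (1 - 2 * poly ?A z) = 0"
    using z by (simp only:)
  hence "1 - 2 * poly ?A z = 0 \<or> poly (pderiv ?A) z = 0"
    by auto
  thus "poly (shabat_poly r t) z \<in> {0, 1}"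
  proof
    assume "1 - 2 * poly ?A z = 0"
    hence half: "poly ?A z = 1/2" by (simp add: field_simps)
    show ?thesis unfolding poly_shabat_poly half by simp
  next
    assume "poly (pderiv ?A) z = 0"
    hence "z = 0 \<or> z = 1"
      using assms by (auto simp: pderiv_inc_beta simp del: of_nat_mult)
    thus ?thesis
      using assms poly_inc_beta_0[of r t] poly_inc_beta_1[of t r] by (auto simp: poly_shabat_poly)
  qed
qed

lemma passport_shabat_poly:
  assumes "r \<ge> 1" "t \<ge> 1"
  shows "passport (dessin (shabat_poly r t)) =
    ({#r, t#} + replicate_mset (r + t - 2) 1, replicate_mset (r + t - 1) 2)"
proof -
  let ?F = "shabat_poly r t"
  define f where "f z = (if poly ?F z = 0 then order z ?F else order z (?F - 1))" for z
  define S where "S = {z. poly ?F z = 0}"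
  define W where "W = {z. poly ?F z = 1}"
  have deg: "degree ?F = 2 * (r + t - 1)" "?F \<noteq> 0" "?F - 1 \<noteq> 0"
    using degree_shabat_poly[OF assms] assms by auto
  have finS: "finite S" using deg poly_roots_finite by (auto simp: S_def)
  have finW: "finite W" using poly_roots_finite[OF deg(3)] by (simp add: W_def)
  have in01: "0 \<in> S" "1 \<in> S"
    using assms poly_inc_beta_0[of r t] poly_inc_beta_1[of t r] by (auto simp: S_def poly_shabat_poly)
  define R where "R = S - {0, 1}"
  have S: "S = insert 0 (insert 1 R)" and R: "finite R" "0 \<notin> R" "1 \<notin> R"
    using in01 finS by (auto simp: R_def)
  have f: "f z = (if z = 0 then r else if z = 1 then t else 1)" if "z \<in> S" for z
    using that order_black_shabat_poly[OF assms, of z] by (simp add: f_def S_def)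
  have fR: "f z = 1" if "z \<in> R" for z
    using f[of z] that by (auto simp: R_def)
  have "(\<Sum>z\<in>S. f z) = degree ?F"
    using sum_order_eq_degree[OF deg(2)] by (simp add: f_def S_def)
  moreover have "(\<Sum>z\<in>S. f z) = r + t + card R"
    using R f[of 0] f[of 1] fR in01 by (simp add: S)
  \<comment> \<open>The orders of all zeros add up to the degree, which leaves this many simple zeros.\<close>
  ultimately have cardR: "card R = r + t - 2" using deg assms by simp
  have black: "image_mset f (mset_set S) = {#r, t#} + replicate_mset (r + t - 2) 1"
  proof -
    have "image_mset f (mset_set R) = image_mset (\<lambda>_. 1) (mset_set R)"
      using R fR by (intro image_mset_cong) auto
    thus ?thesis
      using R f[of 0] f[of 1] in01 by (simp add: S image_mset_const_eq cardR)
  qed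
  have fW: "f z = 2" if "z \<in> W" for z
    using that order_white_shabat_poly[OF assms, of z] by (simp add: f_def W_def)
  have "(\<Sum>z\<in>W. order z (?F - 1)) = degree (?F - 1)"
    using sum_order_eq_degree[OF deg(3)] by (simp add: W_def)
  moreover have "degree (?F - 1) = degree ?F"
    using deg assms degree_add_eq_left[of "-1" ?F] by simp
  moreover have "(\<Sum>z\<in>W. order z (?F - 1)) = (\<Sum>z\<in>W. 2)"
    using order_white_shabat_poly[OF assms] by (intro sum.cong) (auto simp: W_def)
  ultimately have cardW: "card W = r + t - 1" using deg by simp
  have "image_mset f (mset_set W) = image_mset (\<lambda>_. 2) (mset_set W)"
    using finW fW by (intro image_mset_cong) auto
  hence white: "image_mset f (mset_set W) = replicate_mset (r + t - 1) 2"
    by (simp add: image_mset_const_eq cardW)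
  have "f = (\<lambda>z. if poly ?F z = 0 then order z ?F else order z (?F - 1))"
    by (simp add: f_def fun_eq_iff)
  with black white show ?thesis
    by (simp add: passport_def dessin_def S_def W_def)
qed

section \<open>Uniqueness\<close>

lemma poly_all_roots_double_imp_square:
  fixes p :: "complex poly"
  assumes "\<And>z. poly p z = 0 \<Longrightarrow> order z p = 2"
  obtains q where "p = q ^ 2"
proof -
  let ?Q = "\<Prod>z | poly p z = 0. [:-z, 1:]"
  have "p = smult (lead_coeff p) (\<Prod>z | poly p z = 0. [:-z, 1:] ^ order z p)"
    by (rule complex_poly_decompose [symmetric])
  also have "(\<Prod>z | poly p z = 0. [:-z, 1:] ^ order z p) = ?Q ^ 2"
    unfolding prod_power_distrib by (intro prod.cong) (auto simp: assms)
  also have "smult (lead_coeff p) (?Q ^ 2) = smult (csqrt (lead_coeff p)) ?Q ^ 2"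
    by (simp add: smult_power)
  finally show ?thesis by (rule that)
qed

text \<open>
  Since the degree of \<open>B\<close> is smaller than \<open>r + t\<close>, the zeros of \<open>G\<close> of orders \<open>r\<close> and \<open>t\<close> cannot both
  be zeros of \<open>B\<close>. The other zeros of \<open>G\<close> play no role.
\<close>

lemma shabat_isomorphic_if_zero_pair:
  assumes rt: "r \<ge> 1" "t \<ge> 1"
    and G: "G = smult 4 (B * (1 - B))"
    and deg: "degree B = r + t - 1"
    and "b \<noteq> c" "poly B b = 0" "poly G c = 0" "order b G = r" "order c G = t"
  shows "shabat_isomorphic G (shabat_poly r t)"
proof -
  \<comment> \<open>The affine map \<open>z \<mapsto> b + d z\<close> takes 0 to \<open>b\<close> and 1 to \<open>c\<close>.\<close>
  define d where "d = c - b"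
  have d: "d \<noteq> 0" using assms by (simp add: d_def)
  have B0: "B \<noteq> 0" "1 - B \<noteq> 0" "pderiv B \<noteq> 0" using deg rt by (auto simp: pderiv_eq_0_iff)
  have oG: "order z G = order z B + order z (1 - B)" for z
    unfolding G using B0 by (simp add: order_smult order_mult)
  have ob: "order b B = r"
    using oG[of b] assms by (simp add: order_0I)
  have Bc: "poly B c = 1"
  proof (rule ccontr)
    assume "poly B c \<noteq> 1"
    hence c: "poly B c = 0" and "order c (1 - B) = 0"
      using assms(7) by (auto simp: G intro!: order_0I)
    hence oc: "order c B = t" using oG[of c] assms by simp
    have "r + t = (\<Sum>z\<in>{b, c}. order z B)" using ob oc assms by simp
    also have "\<dots> \<le> (\<Sum>z | poly B z = 0. order z B)"
      using c assms B0 poly_roots_finite by (intro sum_mono2) auto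
    also have "\<dots> \<le> degree B" by (rule sum_order_le_degree) fact
    finally show False using deg rt by simp
  qed
  hence oc: "order c (1 - B) = t"
    using oG[of c] assms by (simp add: order_0I)
  have ob': "order b (pderiv B) = r - 1"
    using order_pderiv[of B b] B0 ob assms by simp
  have "pderiv (1 - B) = - pderiv B" by (simp add: pderiv_diff)
  hence oc': "order c (pderiv B) = t - 1"
    using order_pderiv[of "1 - B" c] B0 oc Bc by simp
  obtain u where u: "pderiv B = [:-b, 1:] ^ (r - 1) * u"
    using order_1[of b "pderiv B"] ob' by (auto elim: dvdE)
  have "order c ([:-b, 1:] ^ (r - 1)) = 0"
    using assms by (intro order_0I) simp
  hence "order c u = t - 1"
    using oc' B0 unfolding u by (subst (asm) order_mult) auto
  then obtain v where v: "u = [:-c, 1:] ^ (t - 1) * v"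
    using order_1[of c u] by (auto elim: dvdE)
  have "v \<noteq> 0" using B0 u v by auto
  hence "degree (pderiv B) = r - 1 + (t - 1) + degree v"
    by (simp add: u v degree_mult_eq degree_power_eq)
  hence "degree v = 0" using deg rt by (simp add: degree_pderiv)
  then obtain k where k: "v = [:k:]" by (rule degree_eq_zeroE)
  define D where "D = B \<circ>\<^sub>p [:b, d:]"
  have "D = inc_beta r t"
  proof (rule inc_beta_unique[OF rt])
    show "pderiv D = smult (k * d * d ^ (r - 1) * (-d) ^ (t - 1))
        ([:0, 1:] ^ (r - 1) * [:1, -1:] ^ (t - 1))" (is "_ = ?rhs")
    proof (rule poly_ext)
      fix z
      have "poly (pderiv D) z = d * ((d * z) ^ (r - 1) * ((-d) * (1 - z)) ^ (t - 1) * k)"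
        by (simp add: D_def pderiv_pcompose poly_pcompose pderiv_pCons u v k d_def algebra_simps)
      also have "\<dots> = poly ?rhs z"
        unfolding power_mult_distrib by (simp add: algebra_simps)
      finally show "poly (pderiv D) z = poly ?rhs z" .
    qed
    show "poly D 0 = 0" "poly D 1 = 1"
      using assms Bc by (simp_all add: D_def poly_pcompose d_def)
  qed
  moreover have "poly B z = poly D (1 / d * z + (- b / d))" for z
    using d by (simp add: D_def poly_pcompose field_simps)
  ultimately have "poly G z = poly (shabat_poly r t) (1 / d * z + (- b / d))" for z
    by (simp add: G poly_shabat_poly)
  thus ?thesis unfolding shabat_isomorphic_def by blast
qed

lemma image_mset_eq_pair_plusE:
  assumes "finite S" "image_mset f (mset_set S) = {#x, y#} + M"
  obtains a b where "a \<in> S" "b \<in> S" "a \<noteq> b" "f a = x" "f b = y"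
proof -
  have "x \<in># image_mset f (mset_set S)" using assms by simp
  then obtain a where a: "a \<in> S" "f a = x" using assms(1) by auto
  have "mset_set S = add_mset a (mset_set (S - {a}))"
    using a assms(1) by (simp add: mset_set.remove)
  hence "image_mset f (mset_set (S - {a})) = add_mset y M"
    using assms(2) a by simp
  hence "y \<in># image_mset f (mset_set (S - {a}))" by simp
  then obtain b where "b \<in> S - {a}" "f b = y" using assms(1) by auto
  thus ?thesis using a that by auto
qed

text \<open>
  The black degrees other than \<open>r\<close> and \<open>t\<close> are arbitrary here (\<open>M\<close>).
\<close>

lemma shabat_isomorphic_if_passport:
  assumes rt: "r \<ge> 1" "t \<ge> 1" and "degree G > 0"
    and pass: "passport (dessin G) = ({#r, t#} + M, replicate_mset (r + t - 1) 2)"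
  shows "shabat_isomorphic G (shabat_poly r t)"
proof -
  define f where "f = (\<lambda>z. if poly G z = 0 then order z G else order z (G - 1))"
  define W where "W = {z. poly G z = 1}"
  have G: "G \<noteq> 0" "G - 1 \<noteq> 0" using assms by auto
  have fin: "finite {z. poly G z = 0}" "finite W"
    using poly_roots_finite[OF G(1)] poly_roots_finite[OF G(2)] by (simp_all add: W_def)
  have black: "image_mset f (mset_set {z. poly G z = 0}) = {#r, t#} + M"
    and white: "image_mset f (mset_set W) = replicate_mset (r + t - 1) 2"
    using pass by (simp_all add: passport_def dessin_def f_def W_def)
  obtain b c where bc: "poly G b = 0" "poly G c = 0" "b \<noteq> c" "order b G = r" "order c G = t"
    using image_mset_eq_pair_plusE[OF fin(1) black] by (auto simp: f_def)
  have two: "order z (G - 1) = 2" if "poly (G - 1) z = 0" for z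
  proof -
    have "z \<in> W" using that by (simp add: W_def)
    hence "f z \<in># image_mset f (mset_set W)" using fin by auto
    hence "f z = 2" unfolding white by (simp split: if_splits)
    thus ?thesis using that by (simp add: f_def)
  qed
  have "card W = r + t - 1"
    using arg_cong[OF white, of size] by simp
  moreover have "(\<Sum>z\<in>W. order z (G - 1)) = degree (G - 1)"
    using sum_order_eq_degree[OF G(2)] by (simp add: W_def)
  moreover have "(\<Sum>z\<in>W. order z (G - 1)) = (\<Sum>z\<in>W. 2)"
    by (intro sum.cong refl two) (simp add: W_def)
  ultimately have deg: "degree (G - 1) = 2 * (r + t - 1)" by simp
  obtain q where q: "G - 1 = q ^ 2"
    using poly_all_roots_double_imp_square[of "G - 1"] two by blast
  have degq: "degree q = r + t - 1"
    using deg unfolding q by (cases "q = 0") (use rt in \<open>auto simp: degree_power_eq\<close>)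
  \<comment> \<open>For \<open>e\<^sup>2 = -1\<close>, \<open>1 + q\<^sup>2 = (1 + e q) (1 - e q)\<close>; the sign of \<open>e\<close> is chosen so that \<open>B\<close> vanishes at \<open>b\<close>.\<close>
  define B where "B e = smult (1/2) (1 + smult e q)" for e
  have degB: "degree (B e) = r + t - 1" if "e \<noteq> 0" for e
    using that degq rt degree_add_eq_right[of 1 "smult e q"] by (simp add: B_def)
  have GB: "G = smult 4 (B e * (1 - B e))" if "e ^ 2 = -1" for e
  proof (rule poly_ext)
    fix z
    have "poly G z = 1 + poly q z ^ 2"
      using arg_cong[OF q, of "\<lambda>p. poly p z"] by (simp add: algebra_simps)
    also have "\<dots> = 1 - e ^ 2 * poly q z ^ 2" by (simp add: that)
    also have "\<dots> = poly (smult 4 (B e * (1 - B e))) z"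
      by (simp add: B_def field_simps power2_eq_square)
    finally show "poly G z = poly (smult 4 (B e * (1 - B e))) z" .
  qed
  have "B (- \<i>) = 1 - B \<i>"
    by (rule poly_ext) (simp add: B_def field_simps)
  hence "poly (B \<i>) b = 0 \<or> poly (B (- \<i>)) b = 0"
    using bc(1) GB[of \<i>] by simp
  then obtain e where "e ^ 2 = -1" "e \<noteq> 0" "poly (B e) b = 0"
    by (metis complex_i_not_zero neg_equal_0_iff_equal power2_i power2_minus)
  thus ?thesis
    using shabat_isomorphic_if_zero_pair[OF rt GB degB bc(3)] bc by blast
qed

theorem proposition3:
  fixes r t :: nat
  assumes "r > 1" and "t \<ge> 1"
  shows "\<exists>F :: complex poly.
    fps_of_poly F =
      4 * fps_X ^ r * of_nat ((r + t - 1) choose r)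
        * hyp2F1 (1 - of_nat t) (of_nat r) (of_nat r + 1)
        * (1 - (1 - fps_X) ^ t * fps_X ^ r * of_nat ((r + t - 1) choose (t - 1))
                 * hyp2F1 1 (of_nat r + of_nat t) (of_nat r + 1))
    \<and> shabat F
    \<and> passport (dessin F) =
        ({#r, t#} + replicate_mset (r + t - 2) 1, replicate_mset (r + t - 1) 2)
    \<and> 0 \<in> black (dessin F) \<and> vertex_degree (dessin F) 0 = r
    \<and> 1 \<in> black (dessin F) \<and> vertex_degree (dessin F) 1 = t
    \<and> (\<forall>G. shabat G \<and>
            passport (dessin G) =
              ({#r, t#} + replicate_mset (r + t - 2) 1, replicate_mset (r + t - 1) 2)
          \<longrightarrow> shabat_isomorphic G F)"
proof (rule exI[of _ "shabat_poly r t"], intro conjI allI impI)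
  have rt: "r \<ge> 1" "t \<ge> 1" using assms by auto
  let ?H = "hyp2F1 (1 - of_nat t) (of_nat r) (of_nat r + 1)"
  let ?K = "hyp2F1 1 (of_nat r + of_nat t) (of_nat r + 1)"
  have sym: "(r + t - 1) choose (t - 1) = (r + t - 1) choose r"
    using binomial_symmetric[of r "r + t - 1"] assms by simp
  have A: "fps_of_poly (inc_beta r t) = of_nat ((r + t - 1) choose r) * fps_X ^ r * ?H"
    using fps_eq_inc_beta[OF rt hyp2F1_terminating_ode[OF rt]] by simp
  have A': "fps_of_poly (inc_beta r t) =
      (1 - fps_X) ^ t * fps_X ^ r * of_nat ((r + t - 1) choose (t - 1)) * ?K"
    using fps_eq_inc_beta[OF rt hyp2F1_nonterminating_ode[OF rt]] unfolding sym
    by (simp add: mult_ac)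
  have "fps_of_poly (shabat_poly r t) =
      4 * fps_of_poly (inc_beta r t) * (1 - fps_of_poly (inc_beta r t))"
    by (simp add: shabat_poly_def fps_of_poly_smult fps_of_poly_mult fps_of_poly_diff
        numeral_fps_const)
  thus "fps_of_poly (shabat_poly r t) =
      4 * fps_X ^ r * of_nat ((r + t - 1) choose r) * ?H
        * (1 - (1 - fps_X) ^ t * fps_X ^ r * of_nat ((r + t - 1) choose (t - 1)) * ?K)"
    unfolding A' [symmetric] by (simp add: A mult_ac)
  show "shabat (shabat_poly r t)" by (rule shabat_shabat_poly) fact+
  show "passport (dessin (shabat_poly r t)) =
      ({#r, t#} + replicate_mset (r + t - 2) 1, replicate_mset (r + t - 1) 2)"
    by (rule passport_shabat_poly) fact+
  have roots: "poly (shabat_poly r t) 0 = 0" "poly (shabat_poly r t) 1 = 0"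
    using rt by (simp_all add: poly_shabat_poly poly_inc_beta_0 poly_inc_beta_1)
  thus "0 \<in> black (dessin (shabat_poly r t))" "1 \<in> black (dessin (shabat_poly r t))"
    by (simp_all add: dessin_def)
  show "vertex_degree (dessin (shabat_poly r t)) 0 = r"
    "vertex_degree (dessin (shabat_poly r t)) 1 = t"
    using roots order_black_shabat_poly[OF rt] by (simp_all add: dessin_def)
  fix G
  assume "shabat G \<and> passport (dessin G) =
      ({#r, t#} + replicate_mset (r + t - 2) 1, replicate_mset (r + t - 1) 2)"
  thus "shabat_isomorphic G (shabat_poly r t)"
    using shabat_isomorphic_if_passport[OF rt] by (auto simp: shabat_def)
qed

end
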